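(* Let $p>3$ be a prime. For each integer $d$ with $p\le d\le 2(p-1)$, there exists a function $G\colon\mathbb{F}_{p^2}\to\mathbb{F}_{p^2}$ that is a binomial or a trinomial, is generalized almost perfect nonlinear (GAPN), and has algebraic degree $d$.
   Context: $\mathbb{F}_{p^n}$ denotes the finite field with $p^n$ elements and $\mathbb{F}_{p^n}^*$ its multiplicative group. A function $G\colon\mathbb{F}_{p^n}\to\mathbb{F}_{p^n}$ is GAPN if for all $a\in\mathbb{F}_{p^n}^*$ and $b\in\mathbb{F}_{p^n}$ the equation $\sum_{i\in\mathbb{F}_p}G(X+ia)=b$ has at most $p$ solutions $X\in\mathbb{F}_{p^n}$. For a non-negative integer $u$ with base-$p$ representation $u=\sum_{i\ge 0}h_ip^i$, put $d_p(u)=\sum_{i\ge0}h_i$. The algebraic degree of a nonzero function $G(X)=\sum_{u=0}^{p^n-1}a_uX^u$ (the unique such representation of degree at most $p^n-1$, with $a_u\in\mathbb{F}_{p^n}$) is the maximum of $d_p(u)$ over all $u\in\{0,\dots,p^n-1\}$ with $a_u\ne0$. A binomial (resp. trinomial) over $\mathbb{F}_{p^2}$ is a function whose representation $\sum_{u=0}^{p^2-1}a_uX^u$ has exactly two (resp. three) nonzero coefficients $a_u$. *)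

theory Defs
  imports "HOL-Computational_Algebra.Computational_Algebra" "HOL-Library.Cardinality"
begin

text \<open>
  The field with \<open>p\<^sup>n\<close> elements is an arbitrary type of class \<^class>\<open>finite_field\<close> of
  cardinality \<open>p\<^sup>n\<close>; its prime field is the set of the \<open>p\<close> elements \<open>of_nat i\<close> with \<open>i < p\<close>.
\<close>

definition GAPN :: "nat \<Rightarrow> ('a::finite_field \<Rightarrow> 'a) \<Rightarrow> bool" where
  "GAPN p G \<longleftrightarrow>
     (\<forall>a b. a \<noteq> 0 \<longrightarrow> card {X. (\<Sum>i\<in>of_nat ` {..<p}. G (X + i * a)) = b} \<le> p)"

text \<open>
  The summand is the digit of \<open>u\<close> at position \<open>i\<close>. For \<open>p \<ge> 2\<close> the positions
  \<open>i > u\<close> carry the digit 0, so the range \<open>i \<le> u\<close> covers all digits.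
\<close>

definition digit_sum :: "nat \<Rightarrow> nat \<Rightarrow> nat" where
  "digit_sum p u = (\<Sum>i\<le>u. (u div p ^ i) mod p)"

definition poly_rep :: "('a::finite_field \<Rightarrow> 'a) \<Rightarrow> 'a poly" where
  "poly_rep G = (THE P. degree P \<le> CARD('a) - 1 \<and> (\<forall>x. poly P x = G x))"

lemma ex1_poly_rep:
  fixes G :: "'a::finite_field \<Rightarrow> 'a"
  shows "\<exists>!P. degree P \<le> CARD('a) - 1 \<and> (\<forall>x. poly P x = G x)"
proof (rule ex_ex1I)
  define L :: "'a \<Rightarrow> 'a poly" where "L y = (\<Prod>z\<in>UNIV - {y}. [:-z, 1:])" for y
  define P where "P = (\<Sum>y\<in>UNIV. smult (G y / poly (L y) y) (L y))"
  have deg_L: "degree (L y) = CARD('a) - 1" for y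
    unfolding L_def by (subst degree_prod_eq_sum_degree) (auto simp: card_Diff_singleton)
  have L_self: "poly (L y) y \<noteq> 0" for y
    by (auto simp: L_def poly_prod)
  have L_other: "poly (L y) x = 0" if "x \<noteq> y" for x y
    using that by (auto simp: L_def poly_prod)
  have "degree P \<le> CARD('a) - 1"
    unfolding P_def
    by (rule degree_sum_le) (auto intro: order.trans[OF degree_smult_le] simp: deg_L)
  moreover have "poly P x = G x" for x
  proof -
    have "poly P x = (\<Sum>y\<in>UNIV. if y = x then G x else 0)"
      unfolding P_def poly_sum by (rule sum.cong) (auto simp: L_self L_other)
    then show ?thesis by simp
  qed
  ultimately show "\<exists>P. degree P \<le> CARD('a) - 1 \<and> (\<forall>x. poly P x = G x)"
    by blast
next
  fix P Q :: "'a poly"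
  assume P: "degree P \<le> CARD('a) - 1 \<and> (\<forall>x. poly P x = G x)"
    and Q: "degree Q \<le> CARD('a) - 1 \<and> (\<forall>x. poly Q x = G x)"
  have "0 < card (UNIV :: 'a set)" by (simp add: card_gt_0_iff del: zero_less_card_finite)
  then have "degree P < CARD('a)" "degree Q < CARD('a)"
    using P Q by linarith+
  then show "P = Q"
    using P Q by (intro poly_eqI_degree[of UNIV]) auto
qed

lemma poly_rep:
  fixes G :: "'a::finite_field \<Rightarrow> 'a"
  shows "degree (poly_rep G) \<le> CARD('a) - 1" and "poly (poly_rep G) x = G x"
  using theI'[OF ex1_poly_rep[of G]] by (auto simp: poly_rep_def)

definition exponents :: "('a::finite_field \<Rightarrow> 'a) \<Rightarrow> nat set" where
  "exponents G = {u. coeff (poly_rep G) u \<noteq> 0}"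

text \<open>Only meaningful for \<open>G \<noteq> 0\<close>: for the zero function the set below is empty.\<close>

definition algebraic_degree :: "nat \<Rightarrow> ('a::finite_field \<Rightarrow> 'a) \<Rightarrow> nat" where
  "algebraic_degree p G = Max (digit_sum p ` exponents G)"

definition is_binomial :: "('a::finite_field \<Rightarrow> 'a) \<Rightarrow> bool" where
  "is_binomial G \<longleftrightarrow> card (exponents G) = 2"

definition is_trinomial :: "('a::finite_field \<Rightarrow> 'a) \<Rightarrow> bool" where
  "is_trinomial G \<longleftrightarrow> card (exponents G) = 3"

end

theory Submission
  imports Defs
begin

text \<open>
  Let \<open>N = (p\<^sup>2 - 1) / 2\<close>, so that \<open>a\<^sup>N = \<plusminus>1\<close> is the quadratic character. The function is
  \<open>X\<^sup>u + c\<^sub>2 X\<^bsup>2p-1\<^esup> + c\<^sub>3 X\<^bsup>2p-1+N\<^esup>\<close>, where \<open>u = (d - p + 1) + (p - 1) p\<close> has digit sum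
  \<open>d\<close> and the other two exponents have digit sum \<open>p\<close>. For \<open>a \<noteq> 0\<close> the sum over the translates
  \<open>X + i a\<close> depends only on the class of \<open>X / a\<close> modulo the prime field, hence on a parameter
  \<open>r\<close> in the prime field, and equals \<open>a\<^sup>u C r\<^sup>d - a\<^bsup>2p-1\<^esup> \<kappa>(a) r\<close> up to a constant. Here
  \<open>C\<close> is an eigenvector of Frobenius and \<open>\<kappa>(a) = (2 c\<^sub>2 + 3 c\<^sub>3 a\<^sup>N) \<theta>\<close> takes two values, one
  for squares and one for nonsquares. If two parameters gave the same value, then
  \<open>a\<^bsup>2p-1\<^esup> \<kappa>(a) / a\<^sup>u\<close> would be an eigenvector of Frobenius, which fixes its quadratic
  character; the constants are chosen so that it has the opposite character. For odd \<open>d\<close> this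
  is achieved with \<open>c\<^sub>3 = 0\<close>. The condition \<open>p > 3\<close> is what makes the coefficient \<open>3\<close> nonzero
  and gives \<open>2p-1+N\<close> digit sum \<open>p\<close>.
\<close>

section \<open>Prime field and Frobenius map\<close>

locale prime_square_field =
  fixes p :: nat and field_type :: "'a::finite_field itself"
  assumes prime_p: "prime p" and p_gt_3: "p > 3" and card_field: "CARD('a) = p ^ 2"
begin

abbreviation K :: "'a set" where "K \<equiv> of_nat ` {..<p}"

text \<open>Translation by 1 permutes the field, so summing \<open>x + 1\<close> over all
  \<open>x\<close> shows that \<open>p ^ 2\<close> vanishes in it.\<close>

lemma char_eq: "CHAR('a) = p"
proof -
  have "(\<Sum>x\<in>(UNIV::'a set). x + 1) = (\<Sum>x\<in>UNIV. x)"
    by (rule sum.reindex_bij_witness[of _ "\<lambda>x. x - 1" "\<lambda>x. x + 1"]) auto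
  then have "of_nat (p ^ 2) = (0::'a)"
    using card_field by (simp add: sum.distrib)
  then have "CHAR('a) dvd p ^ 2" by (simp only: of_nat_eq_0_iff_char_dvd)
  then have "CHAR('a) dvd p" using prime_dvd_power[of "CHAR('a)"] by blast
  then show ?thesis using primes_dvd_imp_eq[of "CHAR('a)" p] prime_p by simp
qed

lemma odd_p: "odd p"
  using prime_odd_nat[OF prime_p] p_gt_3 by simp

lemma of_nat_p: "of_nat p = (0::'a)"
  using char_eq of_nat_CHAR[where ?'a='a] by simp

lemma of_nat_neq_0: "of_nat n \<noteq> (0::'a)" if "0 < n" "n < p"
  using that by (auto simp: of_nat_eq_0_iff_char_dvd char_eq dest: dvd_imp_le)

lemma two_neq_0: "(2::'a) \<noteq> 0" and three_neq_0: "(3::'a) \<noteq> 0"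
  using of_nat_neq_0[of 2] of_nat_neq_0[of 3] p_gt_3 by simp_all

lemma minus_one_neq_one: "(-1::'a) \<noteq> 1"
  using two_neq_0 by (metis add.right_inverse one_add_one)

lemma frob_add: "(x + y) ^ p = x ^ p + y ^ p" for x y :: 'a
  by (rule freshmans_dream) (simp_all add: char_eq prime_p)

lemma frob_sum: "sum f A ^ p = (\<Sum>i\<in>A. f i ^ p)" for f :: "'b \<Rightarrow> 'a"
  by (rule freshmans_dream_sum) (simp_all add: char_eq prime_p)

lemma frob_minus: "(- x) ^ p = - (x ^ p)" for x :: 'a
  using odd_p by (rule power_minus_odd)

lemma frob_diff: "(x - y) ^ p = x ^ p - y ^ p" for x y :: 'a
  using frob_add[of x "- y"] by (simp add: frob_minus)

lemma frob_frob: "(x ^ p) ^ p = x" for x :: 'a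
  using finite_field_power_card_eq_same[of x] card_field
  by (simp add: power_mult power2_eq_square)

lemma frob_of_nat: "of_nat n ^ p = (of_nat n :: 'a)"
  using prime_gt_0_nat[OF prime_p] by (induction n) (simp_all add: frob_add)

lemma card_K: "card K = p"
proof -
  have "inj_on (of_nat :: nat \<Rightarrow> 'a) {..<p}"
  proof (rule linorder_inj_onI)
    fix x y assume "x < y" "x \<in> {..<p}" "y \<in> {..<p}"
    then show "of_nat x \<noteq> (of_nat y :: 'a)"
      using of_nat_neq_0[of "y - x"] by (metis (no_types) cancel_comm_monoid_add_class.diff_cancel diff_le_self lessThan_iff less_imp_le of_nat_diff order_le_less_trans zero_less_diff)
  qed auto
  then show ?thesis by (simp add: card_image)
qed

text \<open>The polynomial X^p - X has at most \<open>p\<close> roots, and the \<open>p\<close>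
  elements of \<open>K\<close> are among them.\<close>

lemma K_eq: "K = {x. x ^ p = x}"
proof (rule card_subset_eq)
  let ?P = "monom 1 p + [:0, -1:] :: 'a poly"
  have deg: "degree ?P = p" and nz: "?P \<noteq> 0"
  proof -
    show *: "degree ?P = p"
      using p_gt_3 by (subst degree_add_eq_left) (auto simp: degree_monom_eq)
    show "?P \<noteq> 0" using * p_gt_3 by (metis degree_0 not_less_zero)
  qed
  have "card {x::'a. x ^ p = x} = card {x. poly ?P x = 0}"
    by (simp add: poly_monom)
  also have "\<dots> \<le> p" using card_poly_roots_bound[OF nz] deg by simp
  finally have "card {x::'a. x ^ p = x} \<le> card K" by (simp add: card_K)
  moreover show sub: "K \<subseteq> {x. x ^ p = x}" by (auto simp: frob_of_nat)
  ultimately show "card K = card {x::'a. x ^ p = x}"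
    by (meson card_mono finite le_antisym)
qed simp

lemma K_iff: "x \<in> K \<longleftrightarrow> x ^ p = x" for x :: 'a
  using K_eq by blast

section \<open>Power sums over the prime field\<close>

lemma K_power_pred: "x ^ (p - 1) = 1" if "x \<in> K" "x \<noteq> 0" for x :: 'a
proof -
  have "x * x ^ (p - 1) = x * 1"
    using that p_gt_3 by (simp add: K_iff flip: power_Suc)
  then show ?thesis using that by simp
qed

lemma sum_K_scale: "(\<Sum>i\<in>K. f (r * i)) = (\<Sum>i\<in>K. f i)" if "r \<in> K" "r \<noteq> 0"
  for f :: "'a \<Rightarrow> 'a"
  by (rule sum.reindex_bij_witness[of _ "\<lambda>i. i / r" "\<lambda>i. r * i"])
     (use that in \<open>auto simp: K_iff power_mult_distrib power_divide\<close>)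

lemma sum_K_shift: "(\<Sum>i\<in>K. f (m + i)) = (\<Sum>i\<in>K. f i)" if "m \<in> K" for f :: "'a \<Rightarrow> 'a"
  by (rule sum.reindex_bij_witness[of _ "\<lambda>i. i - m" "\<lambda>i. m + i"])
     (use that in \<open>auto simp: K_iff frob_add frob_diff\<close>)

lemma exists_power_neq_1:
  fixes A :: "'a set"
  assumes "0 < k" "k < card A"
  shows "\<exists>g\<in>A. g ^ k \<noteq> 1"
proof (rule ccontr)
  assume *: "\<not> (\<exists>g\<in>A. g ^ k \<noteq> 1)"
  let ?P = "monom 1 k + [:-1:] :: 'a poly"
  have deg: "degree ?P = k"
    using assms by (subst degree_add_eq_left) (auto simp: degree_monom_eq)
  then have nz: "?P \<noteq> 0" using assms by (metis degree_0 less_irrefl)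
  have "card A \<le> card {x. poly ?P x = 0}"
    using * by (intro card_mono) (auto simp: poly_monom)
  also have "\<dots> \<le> k" using card_poly_roots_bound[OF nz] deg by simp
  finally show False using assms by simp
qed

text \<open>For \<open>k > 0\<close> pick \<open>g\<close> with \<open>g ^ k \<noteq> 1\<close>:
  scaling by \<open>g\<close> permutes \<open>K\<close> but multiplies the sum by
  \<open>g ^ k\<close>. For \<open>k = 0\<close> the sum counts \<open>K\<close>, and
  \<open>p\<close> is 0.\<close>

lemma sum_K_power: "(\<Sum>i\<in>K. i ^ k) = 0" if "k < p - 1"
proof (cases "k = 0")
  case True
  then show ?thesis using of_nat_p card_K by simp
next
  case False
  have "card (K - {0}) = p - 1"
    using p_gt_3 card_K by (subst card_Diff_singleton) (auto simp: K_iff)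
  with that False obtain g where g: "g \<in> K" "g \<noteq> 0" "g ^ k \<noteq> 1"
    using exists_power_neq_1[of k "K - {0}"] by auto
  have "g ^ k * (\<Sum>i\<in>K. i ^ k) = (\<Sum>i\<in>K. i ^ k)"
    using sum_K_scale[OF g(1,2), of "\<lambda>i. i ^ k"] by (simp add: power_mult_distrib sum_distrib_left)
  then show ?thesis using g(3) by simp
qed

lemma sum_K_power_pred: "(\<Sum>i\<in>K. i ^ (p - 1)) = -1"
proof -
  have "(0::'a) \<in> K" using p_gt_3 by (simp add: K_iff)
  then have "(\<Sum>i\<in>K. i ^ (p - 1)) = 0 ^ (p - 1) + (\<Sum>i\<in>K - {0}. i ^ (p - 1))"
    by (intro sum.remove) auto
  also have "(\<Sum>i\<in>K - {0}. i ^ (p - 1)) = (\<Sum>i\<in>K - {0}. 1)"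
    by (rule sum.cong[OF refl], rule K_power_pred) auto
  also have "\<dots> = of_nat (p - 1)"
    using \<open>0 \<in> K\<close> card_K by (simp add: card_Diff_singleton)
  also have "of_nat (p - 1) = (-1 :: 'a)"
    using p_gt_3 by (simp add: of_nat_diff of_nat_p)
  finally show ?thesis using p_gt_3 by simp
qed

lemma sum_K_poly:
  assumes "degree P = p - 1"
  shows "(\<Sum>i\<in>K. poly P i) = - coeff P (p - 1)"
proof -
  have "(\<Sum>i\<in>K. poly P i) = (\<Sum>i\<in>K. \<Sum>k\<le>p - 1. coeff P k * i ^ k)"
    using assms by (simp add: poly_altdef)
  also have "\<dots> = (\<Sum>k\<le>p - 1. coeff P k * (\<Sum>i\<in>K. i ^ k))"
    by (subst sum.swap) (simp add: sum_distrib_left)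
  also have "\<dots> = (\<Sum>k\<le>p - 1. if k = p - 1 then - coeff P (p - 1) else 0)"
    by (intro sum.cong) (auto simp: sum_K_power sum_K_power_pred simp del: One_nat_def)
  finally show ?thesis by simp
qed

section \<open>Sums over a coset of the prime field\<close>

definition \<Phi> :: "nat \<Rightarrow> nat \<Rightarrow> 'a \<Rightarrow> 'a" where
  "\<Phi> h k s = (\<Sum>i\<in>K. (i - s) ^ h * (i + s) ^ k)"

text \<open>
  With \<open>x = X / a\<close>, the translates \<open>x + i\<close> run through a coset of the prime field, which
  contains \<open>-s\<close> because \<open>x + s = (x + x\<^sup>p) / 2\<close> is a trace. On this coset the Frobenius is
  \<open>i - s \<mapsto> i + s\<close>.
\<close>

lemma sum_translates:
  fixes X a :: 'a
  assumes "a \<noteq> 0"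
  shows "(\<Sum>i\<in>K. (X + i * a) ^ (h + k * p)) =
    a ^ (h + k * p) * \<Phi> h k (((X / a) ^ p - X / a) / 2)"
proof -
  define x where "x = X / a"
  define s where "s = (x ^ p - x) / 2"
  define m where "m = (x + x ^ p) / 2"
  have two: "(2::'a) ^ p = 2" using frob_of_nat[of 2] by simp
  have four: "(4::'a) \<noteq> 0" using two_neq_0 no_zero_divisors[of 2 "2::'a"] by simp
  have m: "m \<in> K"
    by (simp add: K_iff m_def power_divide frob_add frob_frob two add.commute)
  have x: "x = m - s" "x ^ p = m + s"
    using two_neq_0 four by (simp_all add: m_def s_def field_simps)
  have "(\<Sum>i\<in>K. (X + i * a) ^ (h + k * p)) = (\<Sum>i\<in>K. a ^ (h + k * p) * (((m + i) - s) ^ h * ((m + i) + s) ^ k))"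
  proof (rule sum.cong[OF refl])
    fix i :: 'a assume i: "i \<in> K"
    have "X + i * a = a * (x + i)" using assms by (simp add: x_def field_simps)
    then have "(X + i * a) ^ (h + k * p) = a ^ (h + k * p) * ((x + i) ^ h * ((x + i) ^ p) ^ k)"
      by (simp add: power_mult_distrib power_add mult.commute flip: power_mult)
    also have "(x + i) ^ p = (m + i) + s"
      using i x by (simp add: frob_add K_iff)
    also have "x + i = (m + i) - s" using x by simp
    finally show "(X + i * a) ^ (h + k * p) = a ^ (h + k * p) * (((m + i) - s) ^ h * ((m + i) + s) ^ k)" .
  qed
  also have "\<dots> = a ^ (h + k * p) * \<Phi> h k s"
    using sum_K_shift[OF m, of "\<lambda>i. (i - s) ^ h * (i + s) ^ k"]
    by (simp add: \<Phi>_def flip: sum_distrib_left)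
  finally show ?thesis by (simp add: s_def x_def)
qed

lemma \<Phi>_degree_pred: "\<Phi> h k s = -1" if "h + k = p - 1"
proof -
  define P where "P = [:-s, 1:] ^ h * [:s, 1:] ^ k"
  have deg: "degree P = p - 1"
    using that by (simp add: P_def degree_mult_eq degree_power_eq)
  have "lead_coeff P = 1"
    unfolding P_def by (simp add: lead_coeff_mult lead_coeff_power)
  then have "coeff P (p - 1) = 1" by (simp add: deg)
  moreover have "\<Phi> h k s = (\<Sum>i\<in>K. poly P i)"
    by (simp add: \<Phi>_def P_def add.commute)
  ultimately show ?thesis using deg sum_K_poly[of P] by simp
qed

text \<open>Writing \<open>i + s = (i - s) + 2 * s\<close> trades one factor for the other at the
  cost of \<open>2 * s\<close> times a sum of total degree \<open>p - 1\<close>, which is -1. At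
  \<open>k = 0\<close> the summand is \<open>i - s ^ p\<close>.\<close>

lemma \<Phi>_degree_p: "\<Phi> (p - k) k s = - 2 * of_nat k * s" if "k \<le> p"
  using that
proof (induction k)
  case 0
  have "\<Phi> p 0 s = (\<Sum>i\<in>K. i ^ 1 - s ^ p)"
    unfolding \<Phi>_def by (rule sum.cong) (auto simp: frob_diff frob_of_nat)
  also have "\<dots> = (\<Sum>i\<in>K. i ^ 1) - of_nat p * s ^ p"
    using card_K by (simp add: sum_subtractf)
  also have "\<dots> = 0" using sum_K_power[of 1] p_gt_3 of_nat_p by simp
  finally show ?case by simp
next
  case (Suc k)
  define h where "h = p - Suc k"
  have h: "p - k = Suc h" "h + k = p - 1" using Suc.prems by (auto simp: h_def)
  have "\<Phi> h (Suc k) s = (\<Sum>i\<in>K. (i - s) ^ Suc h * (i + s) ^ k + 2 * s * ((i - s) ^ h * (i + s) ^ k))"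
    unfolding \<Phi>_def by (rule sum.cong) (auto simp: algebra_simps)
  also have "\<dots> = \<Phi> (Suc h) k s + 2 * s * \<Phi> h k s"
    by (simp add: \<Phi>_def sum.distrib sum_distrib_left)
  also have "\<dots> = - 2 * of_nat (Suc k) * s"
    using Suc h \<Phi>_degree_pred[OF h(2)] by (simp add: algebra_simps)
  finally show ?case by (simp add: h_def)
qed

lemma \<Phi>_scale: "\<Phi> h k (r * s) = r ^ (h + k) * \<Phi> h k s" if "r \<in> K" "r \<noteq> 0"
proof -
  have "\<Phi> h k (r * s) = (\<Sum>i\<in>K. (r * i - r * s) ^ h * (r * i + r * s) ^ k)"
    unfolding \<Phi>_def using sum_K_scale[OF that, of "\<lambda>i. (i - r * s) ^ h * (i + r * s) ^ k"] by simp
  also have "\<dots> = (\<Sum>i\<in>K. r ^ (h + k) * ((i - s) ^ h * (i + s) ^ k))"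
    by (intro sum.cong refl)
       (simp add: power_add power_mult_distrib flip: right_diff_distrib distrib_left)
  finally show ?thesis by (simp add: \<Phi>_def sum_distrib_left)
qed

text \<open>Subtracting the value at 0 turns the scaling rule for nonzero \<open>r\<close> into one
  formula that also covers \<open>r = 0\<close>, where the power vanishes because
  \<open>h + k > 0\<close>.\<close>

lemma \<Phi>_line: "\<Phi> h k (r * s) = \<Phi> h k 0 + r ^ (h + k) * (\<Phi> h k s - \<Phi> h k 0)"
  if "r \<in> K" "h + k > 0"
proof (cases "r = 0")
  case True
  then show ?thesis using that by simp
next
  case False
  then show ?thesis
    using that \<Phi>_scale[of r h k s] \<Phi>_scale[of r h k 0] by (simp add: algebra_simps)
qed

text \<open>Frobenius exchanges \<open>i - s\<close> and \<open>i + s\<close>, which amounts to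
  scaling \<open>s\<close> by -1.\<close>

lemma \<Phi>_frob: "\<Phi> h k s ^ p = (-1) ^ (h + k) * \<Phi> h k s" if "s ^ p = - s"
proof -
  have "\<Phi> h k s ^ p = (\<Sum>i\<in>K. ((i - s) ^ p) ^ h * ((i + s) ^ p) ^ k)"
    by (simp add: \<Phi>_def frob_sum power_mult_distrib mult.commute flip: power_mult)
  also have "\<dots> = (\<Sum>i\<in>K. (i + s) ^ h * (i - s) ^ k)"
    using that by (intro sum.cong refl) (auto simp: frob_diff frob_add frob_of_nat)
  also have "\<dots> = \<Phi> h k (-1 * s)" by (simp add: \<Phi>_def)
  also have "\<dots> = (-1) ^ (h + k) * \<Phi> h k s"
    by (rule \<Phi>_scale) (auto simp: K_iff odd_p)
  finally show ?thesis .
qed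

lemma exists_trace_zero: "\<exists>\<theta>::'a. \<theta> \<noteq> 0 \<and> \<theta> ^ p = - \<theta>"
proof -
  have "card K < CARD('a)"
    using p_gt_3 card_K card_field by (simp add: power2_eq_square)
  then obtain y :: 'a where "y \<notin> K" by (metis UNIV_eq_I less_irrefl)
  then show ?thesis
    \<comment> \<open>This difference is nonzero off \<open>K\<close>, and Frobenius, being an
      involution, changes its sign.\<close>
    by (intro exI[of _ "y ^ p - y"]) (auto simp: K_iff frob_diff frob_frob)
qed

section \<open>Quadratic character and digits of the exponents\<close>

definition m :: nat where "m = (p + 1) div 2"

text \<open>Kept in the factored form so that \<open>x ^ N\<close> is the \<open>m\<close>-th power
  of \<open>x ^ (p - 1)\<close>, the Frobenius eigenvalue when \<open>x\<close> is an
  eigenvector.\<close>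

definition N :: nat where "N = (p - 1) * m"

lemma p_plus_1: "p + 1 = 2 * m"
  using odd_p by (auto simp: m_def)

lemma m_ge: "m \<ge> 3"
  using p_plus_1 p_gt_3 odd_p by presburger

lemma N_twice: "2 * N + 1 = p ^ 2"
proof -
  obtain k where k: "p = 2 * k + 1" using odd_p by (elim oddE)
  then have "m = k + 1" using p_plus_1 by simp
  then have "N = 2 * k * (k + 1)" unfolding N_def using k by simp
  then show ?thesis using k by (simp add: power2_eq_square algebra_simps)
qed

lemma even_N: "even N"
  using odd_p by (simp add: N_def)

lemma v_digits: "2 * p - 1 = (p - 1) + 1 * p"
  using p_gt_3 by simp

text \<open>Since \<open>N = m * p - m\<close>, the exponent is
  \<open>(m + 2) * p - (m + 1)\<close>; borrowing one \<open>p\<close> gives the digits.\<close>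

lemma w_digits: "2 * p - 1 + N = (p - (m + 1)) + (m + 1) * p"
proof -
  obtain k where k: "m = k + 3" using m_ge by (metis add.commute le_Suc_ex)
  then have "p = 2 * k + 5" using p_plus_1 by simp
  then show ?thesis unfolding N_def using k by (simp add: algebra_simps)
qed

lemma power_N_cases: "x ^ N = 1 \<or> x ^ N = -1" if "x \<noteq> 0" for x :: 'a
proof -
  have "x * (x ^ N) ^ 2 = x * 1"
    using N_twice card_field finite_field_power_card_eq_same[of x]
    by (simp flip: power_mult power_Suc add: mult.commute)
  then show ?thesis using that by (simp add: power2_eq_1_iff)
qed

lemma exists_nonsquare: "\<exists>n::'a. n \<noteq> 0 \<and> n ^ N = -1"
proof -
  have "N > 0" using p_gt_3 m_ge by (simp add: N_def)
  moreover from this have "N < p ^ 2 - 1" using N_twice by linarith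
  ultimately have "\<exists>g\<in>UNIV - {0::'a}. g ^ N \<noteq> 1"
    using card_field by (intro exists_power_neq_1) (auto simp: card_Diff_singleton)
  then show ?thesis using power_N_cases by blast
qed

text \<open>Here \<open>w ^ (p - 1) = \<sigma>\<close>, so the quadratic character of an eigenvector
  depends only on its eigenvalue.\<close>

lemma power_N_frob_eigen: "w ^ N = \<sigma> ^ m" if "w \<noteq> 0" "w ^ p = \<sigma> * w" for w \<sigma> :: 'a
proof -
  have "w * w ^ (p - 1) = w * \<sigma>"
    using that p_gt_3 by (simp add: mult.commute flip: power_Suc)
  then have "w ^ (p - 1) = \<sigma>" using that by simp
  then show ?thesis by (simp add: N_def power_mult)
qed


section \<open>GAPN criterion by quadratic characters\<close>

text \<open>The hypothesis \<open>char\<close> excludes the character that a collision between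
  different values of \<open>r\<close> would force. Each fibre then lies in a single coset
  \<open>X + K a\<close>, which has at most \<open>p\<close> elements.\<close>

lemma GAPN_family:
  fixes \<theta> c\<^sub>2 c\<^sub>3 :: 'a and h k :: nat
  defines "\<kappa> a \<equiv> (2 * c\<^sub>2 + 3 * c\<^sub>3 * a ^ N) * \<theta>"
  assumes \<theta>: "\<theta> \<noteq> 0" "\<theta> ^ p = - \<theta>" and hk: "h + k > 0"
    and \<kappa>: "\<And>a. a \<noteq> 0 \<Longrightarrow> \<kappa> a \<noteq> 0"
    and char: "\<And>a. a \<noteq> 0 \<Longrightarrow>
      (a ^ (2 * p - 1) * \<kappa> a) ^ N \<noteq> (a ^ (h + k * p)) ^ N * ((-1) ^ (h + k)) ^ m"
  shows "GAPN p (\<lambda>x. x ^ (h + k * p) + c\<^sub>2 * x ^ (2 * p - 1) + c\<^sub>3 * x ^ (2 * p - 1 + N))"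
    (is "GAPN p ?G")
  unfolding GAPN_def
proof (intro allI impI)
  fix a b :: 'a
  assume a: "a \<noteq> 0"
  define s where "s X = ((X / a) ^ p - X / a) / 2" for X
  \<comment> \<open>Frobenius negates both \<open>s X\<close> and \<open>\<theta>\<close>, so their
    quotient lies in \<open>K\<close>.\<close>
  define r where "r X = s X / \<theta>" for X
  define C where "C = \<Phi> h k \<theta> - \<Phi> h k 0"
  have two: "(2::'a) ^ p = 2" using frob_of_nat[of 2] by simp
  have s: "s X = r X * \<theta>" for X using \<theta> by (simp add: r_def)
  have "s X ^ p = - s X" for X
    by (simp add: s_def power_divide[of _ 2] frob_diff frob_frob two minus_divide_left)
  then have r_K: "r X \<in> K" for X
    using \<theta> by (simp add: K_iff r_def power_divide)
  \<comment> \<open>The coefficient is \<open>2 * (m + 1) = p + 3\<close>, which reduces to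
    3.\<close>
  have \<Phi>3: "\<Phi> (p - (m + 1)) (m + 1) t = - 3 * t" for t
  proof -
    have "2 * of_nat (m + 1) = (of_nat (2 * m + 2) :: 'a)" by simp
    also have "2 * m + 2 = p + 3" using p_plus_1 by simp
    also have "of_nat (p + 3) = (3::'a)" by (simp add: of_nat_p)
    finally have "2 * of_nat (m + 1) = (3::'a)" .
    moreover have "m + 1 \<le> p" using p_plus_1 m_ge by linarith
    ultimately show ?thesis
      by (simp only: \<Phi>_degree_p mult_minus_left)
  qed
  have D: "(\<Sum>i\<in>K. ?G (X + i * a)) =
      a ^ (h + k * p) * \<Phi> h k 0 + (a ^ (h + k * p) * C * r X ^ (h + k) - a ^ (2 * p - 1) * \<kappa> a * r X)" for X
  proof -
    have "(\<Sum>i\<in>K. ?G (X + i * a)) = a ^ (h + k * p) * \<Phi> h k (s X)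
        + c\<^sub>2 * (a ^ (2 * p - 1) * \<Phi> (p - 1) 1 (s X))
        + c\<^sub>3 * (a ^ (2 * p - 1 + N) * \<Phi> (p - (m + 1)) (m + 1) (s X))"
      unfolding sum.distrib sum_distrib_left[symmetric] s_def w_digits
      unfolding v_digits sum_translates[OF a] ..
    also have "\<Phi> h k (s X) = \<Phi> h k 0 + r X ^ (h + k) * C"
      unfolding s C_def by (rule \<Phi>_line[OF r_K hk])
    also have "\<Phi> (p - 1) 1 (s X) = - 2 * s X"
      using \<Phi>_degree_p[of 1] p_gt_3 by simp
    also have "\<Phi> (p - (m + 1)) (m + 1) (s X) = - 3 * s X" by (rule \<Phi>3)
    finally show ?thesis
      by (simp add: s \<kappa>_def power_add algebra_simps)
  qed
  have C_frob: "C ^ p = (-1) ^ (h + k) * C"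
    unfolding C_def frob_diff using \<theta> p_gt_3 \<Phi>_frob[of \<theta> h k] \<Phi>_frob[of 0 h k]
    by (simp add: right_diff_distrib)
  have inj: "Y - X \<in> (\<lambda>i. i * a) ` K"
    if eq: "(\<Sum>i\<in>K. ?G (X + i * a)) = (\<Sum>i\<in>K. ?G (Y + i * a))" for X Y
  proof -
    have "r X = r Y"
    proof (rule ccontr)
      assume neq: "r X \<noteq> r Y"
      \<comment> \<open>The difference quotient lies in \<open>K\<close>, so \<open>w\<close>
        inherits the Frobenius eigenvalue of \<open>C\<close>.\<close>
      define w where "w = C * ((r X ^ (h + k) - r Y ^ (h + k)) / (r X - r Y))"
      have "a ^ (h + k * p) * C * r X ^ (h + k) - a ^ (2 * p - 1) * \<kappa> a * r X =
          a ^ (h + k * p) * C * r Y ^ (h + k) - a ^ (2 * p - 1) * \<kappa> a * r Y"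
        using eq unfolding D by (rule add_left_imp_eq)
      then have "a ^ (2 * p - 1) * \<kappa> a * (r X - r Y) =
          a ^ (h + k * p) * (C * (r X ^ (h + k) - r Y ^ (h + k)))"
        by (simp add: algebra_simps)
      then have w: "a ^ (2 * p - 1) * \<kappa> a = a ^ (h + k * p) * w"
        using neq by (simp add: w_def field_simps)
      then have "w \<noteq> 0" using a \<kappa>[OF a] by auto
      have r_frob: "r Z ^ p = r Z" for Z using r_K K_iff by blast
      have "(r Z ^ n) ^ p = r Z ^ n" for Z n
        by (metis r_frob mult.commute power_mult)
      then have "w ^ p = (-1) ^ (h + k) * w"
        by (simp add: w_def power_mult_distrib power_divide C_frob frob_diff r_frob)
      then have "w ^ N = ((-1) ^ (h + k)) ^ m"
        using \<open>w \<noteq> 0\<close> by (intro power_N_frob_eigen)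
      then show False using char[OF a] unfolding w by (simp add: power_mult_distrib)
    qed
    then have "s X = s Y" by (simp add: s)
    then have "(X / a) ^ p - X / a = (Y / a) ^ p - Y / a"
      using two_neq_0 by (simp only: s_def divide_cancel_right simp_thms)
    moreover have "C - A = D - B" if "A - B = C - D" for A B C D :: 'a
      using that by algebra
    ultimately have "(Y / a - X / a) ^ p = Y / a - X / a"
      unfolding frob_diff by blast
    then have "Y / a - X / a \<in> K" by (simp only: K_iff)
    moreover have "Y - X = (Y / a - X / a) * a" using a by (simp add: field_simps)
    ultimately show ?thesis by blast
  qed
  let ?S = "{X. (\<Sum>i\<in>K. ?G (X + i * a)) = b}"
  show "card ?S \<le> p"
  proof (cases "?S = {}")
    case True
    then show ?thesis by simp
  next
    case False
    then obtain X where X: "X \<in> ?S" by blast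
    have "?S \<subseteq> (\<lambda>i. X + i * a) ` K"
    proof
      fix Y assume "Y \<in> ?S"
      then have "Y - X \<in> (\<lambda>i. i * a) ` K" using X by (intro inj) simp
      then obtain i where "i \<in> K" "Y - X = i * a" by blast
      then show "Y \<in> (\<lambda>i. X + i * a) ` K" by (intro image_eqI[of _ _ i]) (auto simp: algebra_simps)
    qed
    then have "card ?S \<le> card ((\<lambda>i. X + i * a) ` K)" by (intro card_mono) auto
    also have "\<dots> \<le> p" using card_image_le[of K] card_K by (metis finite)
    finally show ?thesis .
  qed
qed

end

section \<open>Exponents and digit sums of explicit functions\<close>

lemma poly_rep_eqI:
  fixes G :: "'a::finite_field \<Rightarrow> 'a"
  assumes "degree P \<le> CARD('a) - 1" "\<And>x. poly P x = G x"
  shows "poly_rep G = P"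
  using ex1_poly_rep[of G] poly_rep[of G] assms by blast

text \<open>Distinctness from \<open>w\<close> is tied to a nonzero third coefficient so that
  binomials are covered too: for \<open>p = d = 5\<close> the exponents \<open>u\<close> and
  \<open>w\<close> of the main proof coincide.\<close>

lemma exponents_three_terms:
  fixes c\<^sub>1 c\<^sub>2 c\<^sub>3 :: "'a::finite_field"
  assumes "u < CARD('a)" "v < CARD('a)" "w < CARD('a)" "u \<noteq> v" and "c\<^sub>3 \<noteq> 0 \<Longrightarrow> u \<noteq> w \<and> v \<noteq> w"
  shows "exponents (\<lambda>x. c\<^sub>1 * x ^ u + c\<^sub>2 * x ^ v + c\<^sub>3 * x ^ w) =
    (if c\<^sub>1 = 0 then {} else {u}) \<union> (if c\<^sub>2 = 0 then {} else {v}) \<union> (if c\<^sub>3 = 0 then {} else {w})"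
proof -
  let ?P = "monom c\<^sub>1 u + monom c\<^sub>2 v + monom c\<^sub>3 w"
  have "degree (monom c e) \<le> CARD('a) - 1" if "e < CARD('a)" for c :: 'a and e
    using degree_monom_le[of c e] that by linarith
  then have "degree ?P \<le> CARD('a) - 1"
    using assms by (intro degree_add_le) auto
  then have "poly_rep (\<lambda>x. c\<^sub>1 * x ^ u + c\<^sub>2 * x ^ v + c\<^sub>3 * x ^ w) = ?P"
    by (rule poly_rep_eqI) (simp add: poly_monom)
  then show ?thesis
    using assms by (cases "c\<^sub>3 = 0") (auto simp: exponents_def split: if_splits)
qed

lemma two_digits_less:
  fixes h k p :: nat
  assumes "h < p" "k < p"
  shows "h + k * p < p ^ 2"
proof -
  have "h + k * p < Suc k * p" using assms by simp
  also have "\<dots> \<le> p * p" using assms by (intro mult_le_mono1) simp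
  finally show ?thesis by (simp add: power2_eq_square)
qed

lemma digit_sum_two_digits:
  assumes "h < p" "k < p" "1 < p"
  shows "digit_sum p (h + k * p) = h + k"
\<comment> \<open>For the value 0 the range of \<open>digit_sum\<close> misses position 1.\<close>
proof (cases "h + k * p = 0")
  case True
  then show ?thesis using assms by (simp add: digit_sum_def)
next
  case False
  let ?u = "h + k * p"
  have u: "?u < p ^ 2" using assms by (intro two_digits_less)
  have "(\<Sum>i\<le>?u. (?u div p ^ i) mod p) = (\<Sum>i\<in>{0, 1}. (?u div p ^ i) mod p)"
  proof (rule sum.mono_neutral_right)
    show "\<forall>i\<in>{..?u} - {0, 1}. ?u div p ^ i mod p = 0"
    proof
      fix i assume "i \<in> {..?u} - {0, 1}"
      then have "p ^ 2 \<le> p ^ i" using assms by (intro power_increasing) auto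
      then show "?u div p ^ i mod p = 0" using u by simp
    qed
    show "{0, 1} \<subseteq> {..?u}" using False by (simp only: atMost_iff insert_subset empty_subsetI simp_thms) linarith
  qed simp
  then show ?thesis using assms by (simp add: digit_sum_def)
qed

section \<open>Choice of the coefficients\<close>

theorem mainTheorem1:
  fixes p d :: nat
  assumes "prime p" and "p > 3"
    and "CARD('a::finite_field) = p ^ 2"
    and "p \<le> d" and "d \<le> 2 * (p - 1)"
  shows "\<exists>G :: 'a \<Rightarrow> 'a.
    (is_binomial G \<or> is_trinomial G) \<and> GAPN p G \<and> algebraic_degree p G = d"
proof -
  interpret prime_square_field p "TYPE('a)"
    by unfold_locales (use assms in auto)
  define h k where "h = d - (p - 1)" and "k = p - 1"
  have hk: "h + k = d" "0 < h" "h < p" "k < p"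
    using assms by (auto simp: h_def k_def)
  define u v w where "u = h + k * p" and "v = 2 * p - 1" and "w = 2 * p - 1 + N"
  have m: "m + 1 < p" using p_plus_1 m_ge by linarith
  have ds: "digit_sum p u = d" "digit_sum p v = p" "digit_sum p w = p"
    unfolding u_def v_def w_def unfolding w_digits unfolding v_digits
    using m hk p_gt_3 by (subst digit_sum_two_digits; simp)+
  have lt: "u < CARD('a)" "v < CARD('a)" "w < CARD('a)"
    unfolding u_def v_def w_def card_field unfolding w_digits unfolding v_digits
    using m hk p_gt_3 by (intro two_digits_less; simp)+
  have "N > 0" using m_ge p_gt_3 by (simp add: N_def)
  then have vw: "v \<noteq> w" by (simp add: v_def w_def)
  \<comment> \<open>Digit sums do not separate these exponents when \<open>d = p\<close>, so they
    are compared by size.\<close>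
  have uv: "u \<noteq> v"
  proof -
    have "2 * p \<le> k * p" using p_gt_3 by (intro mult_le_mono1) (simp add: k_def)
    then have "v < u" unfolding u_def v_def using hk(2) p_gt_3 by linarith
    then show ?thesis by simp
  qed
  \<comment> \<open>As \<open>a ^ N\<close> is 1 or -1, only parities of exponents matter, and
    \<open>u\<close> has the parity of \<open>h + k = d\<close> because \<open>p\<close> is
    odd.\<close>
  have sign: "(a ^ u) ^ N = (if even d then 1 else a ^ N)"
    and sign_v: "(a ^ v) ^ N = a ^ N" if "a \<noteq> 0" for a :: 'a
  proof -
    have "even u \<longleftrightarrow> even d" using odd_p by (simp add: u_def flip: hk(1))
    moreover have "odd v" using p_gt_3 by (simp add: v_def)
    moreover have "(a ^ e) ^ N = (a ^ N) ^ e" for e by (metis mult.commute power_mult)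
    ultimately show "(a ^ u) ^ N = (if even d then 1 else a ^ N)" "(a ^ v) ^ N = a ^ N"
      using power_N_cases[OF that] by auto
  qed
  obtain \<theta> :: 'a where \<theta>: "\<theta> \<noteq> 0" "\<theta> ^ p = - \<theta>" using exists_trace_zero by blast
  obtain n :: 'a where n: "n \<noteq> 0" "n ^ N = -1" using exists_nonsquare by blast
  show ?thesis
  proof (cases "even d")
    case False
    \<comment> \<open>For odd \<open>d\<close> the factor \<open>a ^ N\<close> occurs on both sides
      of the character condition, so a constant suffices: 1 or \<open>n\<close>, according to the
      parity of \<open>m\<close>.\<close>
    obtain \<kappa> :: 'a where \<kappa>: "\<kappa> \<noteq> 0" "\<kappa> ^ N \<noteq> (-1) ^ m"
      using n minus_one_neq_one by (cases "even m") (metis power_one uminus_power_if zero_neq_one)+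
    define c where "c = \<kappa> / (2 * \<theta>)"
    have c: "c \<noteq> 0" using \<kappa> \<theta> two_neq_0 by (simp add: c_def)
    define G where "G = (\<lambda>x::'a. x ^ u + c * x ^ v + 0 * x ^ w)"
    have \<kappa>_eq: "(2 * c + 3 * 0 * a ^ N) * \<theta> = \<kappa>" for a
      using \<theta> two_neq_0 by (simp add: c_def)
    have "GAPN p G"
      unfolding G_def u_def v_def w_def
    proof (rule GAPN_family[of \<theta>], unfold \<kappa>_eq)
      fix a :: 'a assume a: "a \<noteq> 0"
      then show "(a ^ (2 * p - 1) * \<kappa>) ^ N \<noteq> (a ^ (h + k * p)) ^ N * ((- 1) ^ (h + k)) ^ m"
        using \<kappa> False sign[OF a] sign_v[OF a] hk(1) unfolding u_def v_def
        by (simp add: power_mult_distrib)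
    qed (use \<theta> hk \<kappa> in auto)
    moreover have "exponents G = {u, v}"
      using exponents_three_terms[OF lt uv, of 0 1 c] c by (auto simp: G_def)
    ultimately show ?thesis
      using uv ds \<open>p \<le> d\<close>
      by (intro exI[of _ G]) (simp add: is_binomial_def algebraic_degree_def)
  next
    case True
    \<comment> \<open>So \<open>d\<close> exceeds the digit sum \<open>p\<close> of
      \<open>w\<close>.\<close>
    then have "d \<noteq> p" using odd_p by auto
    then have uw: "u \<noteq> w" using ds by auto
    \<comment> \<open>These solve the two linear equations asking that \<open>\<kappa>(a)\<close> be
      \<open>n\<close> on squares and 1 on nonsquares. Its character is then
      \<open>- (a ^ N)\<close>, so the left side of the condition is -1 and the right side is
      1.\<close>
    define c\<^sub>2 c\<^sub>3 where "c\<^sub>2 = (n + 1) / 2 / (2 * \<theta>)" and "c\<^sub>3 = (n - 1) / 2 / (3 * \<theta>)"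
    \<comment> \<open>Both 1 and -1 are squares because \<open>N\<close> is even; hence neither
      coefficient vanishes.\<close>
    have "n \<noteq> 1" "n \<noteq> -1" using n even_N minus_one_neq_one by auto
    then have c: "c\<^sub>2 \<noteq> 0" "c\<^sub>3 \<noteq> 0"
      using \<theta> two_neq_0 three_neq_0
      by (simp_all add: c\<^sub>2_def c\<^sub>3_def eq_neg_iff_add_eq_0 del: divide_divide_eq_left)
    define G where "G = (\<lambda>x::'a. x ^ u + c\<^sub>2 * x ^ v + c\<^sub>3 * x ^ w)"
    have \<kappa>_eq: "(2 * c\<^sub>2 + 3 * c\<^sub>3 * a ^ N) * \<theta> = (if a ^ N = 1 then n else 1)" if "a \<noteq> 0" for a
    proof -
      have "2 * c\<^sub>2 * \<theta> = (n + 1) / 2" "3 * c\<^sub>3 * \<theta> = (n - 1) / 2"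
        using \<theta> two_neq_0 three_neq_0
        by (simp_all add: c\<^sub>2_def c\<^sub>3_def del: divide_divide_eq_left)
      moreover have "(2 * c\<^sub>2 + 3 * c\<^sub>3 * a ^ N) * \<theta> = 2 * c\<^sub>2 * \<theta> + 3 * c\<^sub>3 * \<theta> * a ^ N"
        by (simp add: distrib_right)
      ultimately have "(2 * c\<^sub>2 + 3 * c\<^sub>3 * a ^ N) * \<theta> = (n + 1) / 2 + (n - 1) / 2 * a ^ N"
        by (simp only:)
      also have "\<dots> = (if a ^ N = 1 then n else 1)"
        using power_N_cases[OF that]
      proof
        assume "a ^ N = -1"
        then show ?thesis
          using minus_one_neq_one two_neq_0 by (simp flip: diff_divide_distrib)
      qed (use two_neq_0 in \<open>simp flip: add_divide_distrib\<close>)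
      finally show ?thesis .
    qed
    have "GAPN p G"
      unfolding G_def u_def v_def w_def
    proof (rule GAPN_family[of \<theta>])
      fix a :: 'a assume a: "a \<noteq> 0"
      show "(2 * c\<^sub>2 + 3 * c\<^sub>3 * a ^ N) * \<theta> \<noteq> 0"
        using n unfolding \<kappa>_eq[OF a] by simp
      show "(a ^ (2 * p - 1) * ((2 * c\<^sub>2 + 3 * c\<^sub>3 * a ^ N) * \<theta>)) ^ N
          \<noteq> (a ^ (h + k * p)) ^ N * ((- 1) ^ (h + k)) ^ m"
        using n True sign[OF a] sign_v[OF a] hk(1) power_N_cases[OF a] minus_one_neq_one
        unfolding u_def v_def \<kappa>_eq[OF a]
        by (auto simp: power_mult_distrib)
    qed (use \<theta> hk in auto)
    moreover have "exponents G = {u, v, w}"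
      using exponents_three_terms[OF lt uv, of c\<^sub>3 1 c\<^sub>2] c uw vw by (auto simp: G_def)
    ultimately show ?thesis
      using uv uw vw ds \<open>p \<le> d\<close>
      by (intro exI[of _ G]) (simp add: is_trinomial_def algebraic_degree_def)
  qed
qed

end
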